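(* If $G$ is an $n$-connector, then $G$ is $(k,n-k)$-ST-robust for all $1\le k\le n$.
   Context: A DAG $G$ with $n$ inputs and $n$ outputs is an $n$-connector if for every $1\le r\le n$, every ordered list $x_1,\dots,x_r$ of distinct inputs and every ordered list $y_1,\dots,y_r$ of distinct outputs, there are $r$ vertex-disjoint paths in $G$ connecting $x_i$ to $y_i$ for each $i\le r$. For a DAG $G=(V,E)$ with a set $I$ of $n$ inputs and a set $O$ of $n$ outputs, $G$ is $(k_1,k_2)$-ST-robust if for every $D\subseteq V$ with $|D|\le k_1$ there is a subgraph $H$ of $G-D$ with $|I\cap V(H)|\ge k_2$ and $|O\cap V(H)|\ge k_2$ such that for every $s\in I\cap V(H)$ and every $t\in O\cap V(H)$ there is a directed path from $s$ to $t$ in $H$. *)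

theory Defs
  imports "Graph_Theory.Graph_Theory"
begin

definition dag :: "('a, 'b) pre_digraph \<Rightarrow> bool" where
  "dag G \<longleftrightarrow> digraph G \<and> \<not> (\<exists>c. pre_digraph.cycle G c)"

text \<open>
  Inputs and outputs are designated sets of vertices; they are not required to be sources or
  sinks of the graph, nor to be disjoint.
\<close>

definition io_dag :: "nat \<Rightarrow> ('a, 'b) pre_digraph \<Rightarrow> 'a set \<Rightarrow> 'a set \<Rightarrow> bool" where
  "io_dag n G ins outs \<longleftrightarrow>
     dag G \<and> ins \<subseteq> verts G \<and> outs \<subseteq> verts G \<and> card ins = n \<and> card outs = n"

text \<open>
  Vertex-disjointness concerns all vertices of the paths, endpoints included. A path may
  have length zero.
\<close>

definition connector :: "nat \<Rightarrow> ('a, 'b) pre_digraph \<Rightarrow> 'a set \<Rightarrow> 'a set \<Rightarrow> bool" where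
  "connector n G ins outs \<longleftrightarrow>
     io_dag n G ins outs \<and>
     (\<forall>r xs ys.
        1 \<le> r \<and> r \<le> n \<and>
        length xs = r \<and> distinct xs \<and> set xs \<subseteq> ins \<and>
        length ys = r \<and> distinct ys \<and> set ys \<subseteq> outs \<longrightarrow>
        (\<exists>p :: nat \<Rightarrow> 'b awalk.
           (\<forall>i<r. pre_digraph.apath G (xs ! i) (p i) (ys ! i)) \<and>
           (\<forall>i<r. \<forall>j<r. i \<noteq> j \<longrightarrow>
              set (pre_digraph.awalk_verts G (xs ! i) (p i)) \<inter>
              set (pre_digraph.awalk_verts G (xs ! j) (p j)) = {})))"

definition ST_robust ::
    "nat \<Rightarrow> ('a, 'b) pre_digraph \<Rightarrow> 'a set \<Rightarrow> 'a set \<Rightarrow> nat \<Rightarrow> nat \<Rightarrow> bool" where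
  "ST_robust n G ins outs k1 k2 \<longleftrightarrow>
     io_dag n G ins outs \<and>
     (\<forall>D. D \<subseteq> verts G \<and> card D \<le> k1 \<longrightarrow>
        (\<exists>H. subgraph H (G \<restriction> (verts G - D)) \<and>
             card (ins \<inter> verts H) \<ge> k2 \<and>
             card (outs \<inter> verts H) \<ge> k2 \<and>
             (\<forall>s \<in> ins \<inter> verts H. \<forall>t \<in> outs \<inter> verts H. \<exists>p. pre_digraph.apath H s p t)))"

end

theory Submission
  imports Defs
begin

text \<open>
  Delete \<open>D\<close> and call a pair of an input \<open>s\<close> and an output \<open>t\<close> bad if every path from \<open>s\<close> to \<open>t\<close>
  meets \<open>D\<close> or passes through a further input or output. Extend a matching of bad pairs to a
  bijection between all inputs and all outputs: the vertex-disjoint paths of the connector then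
  use up all terminals, so each of them avoids the terminals of the others, and hence each path
  joining a bad pair contains its own vertex of \<open>D\<close>. Thus a matching of bad pairs has at most
  \<open>|D|\<close> edges. Removing the terminals of a maximum matching leaves no bad pair, at the cost of at
  most \<open>|D|\<close> inputs and at most \<open>|D|\<close> outputs.

  Paths through further terminals count as bad because inputs need not be sources and outputs need
  not be sinks: a terminal inside a path would itself belong to the subgraph \<open>H\<close>.
\<close>

definition clean_path ::
    "('a, 'b) pre_digraph \<Rightarrow> 'a set \<Rightarrow> 'a set \<Rightarrow> 'a set \<Rightarrow> 'a \<Rightarrow> 'b awalk \<Rightarrow> 'a \<Rightarrow> bool" where
  "clean_path G ins outs D s p t \<longleftrightarrow>
     pre_digraph.apath G s p t \<and>
     set (pre_digraph.awalk_verts G s p) \<inter> D = {} \<and>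
     set (pre_digraph.awalk_verts G s p) \<inter> ins \<subseteq> {s} \<and>
     set (pre_digraph.awalk_verts G s p) \<inter> outs \<subseteq> {t}"

text \<open>A list rather than a set of pairs, so that its two projections can be prolonged to the
  ordered lists of terminals that \<open>connector\<close> quantifies over.\<close>

definition bad_matching ::
    "('a, 'b) pre_digraph \<Rightarrow> 'a set \<Rightarrow> 'a set \<Rightarrow> 'a set \<Rightarrow> ('a \<times> 'a) list \<Rightarrow> bool" where
  "bad_matching G ins outs D zs \<longleftrightarrow>
     distinct (map fst zs) \<and> distinct (map snd zs) \<and>
     (\<forall>(s, t) \<in> set zs. s \<in> ins \<and> t \<in> outs \<and> (\<nexists>p. clean_path G ins outs D s p t))"

lemma distinct_list_extend:
  assumes "finite A" "distinct xs" "set xs \<subseteq> A"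
  obtains ys where "distinct (xs @ ys)" "set (xs @ ys) = A"
proof -
  obtain ys where "set ys = A - set xs" "distinct ys"
    using finite_distinct_list assms(1) by (metis finite_Diff)
  with assms that show thesis by auto
qed

lemma (in wf_digraph) apath_induce_subgraph:
  assumes p: "apath u p v" and S: "set (awalk_verts u p) \<subseteq> S"
  shows "pre_digraph.apath (G \<restriction> S) u p v"
proof -
  have w: "awalk u p v" using p by (simp add: apath_def)
  \<comment> \<open>An induced subgraph keeps \<open>tail\<close> and \<open>head\<close>, so only
    the membership of the arcs and, since \<open>p\<close> may be empty, of the start vertex remains
    to be checked.\<close>
  have c: "pre_digraph.cas (G \<restriction> S) = cas" "pre_digraph.awalk_verts (G \<restriction> S) = awalk_verts"
    using compatible_induce_subgraph compatible_cas compatible_awalk_verts by blast+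
  have "set p \<subseteq> arcs (G \<restriction> S)"
    using w S awalk_verts_arc1[of _ p u] awalk_verts_arc2[OF w] by (auto simp: awalk_def)
  moreover have "u \<in> S" using hd_in_awalk_verts(1)[OF w] S by blast
  ultimately show ?thesis
    using p by (auto simp: pre_digraph.apath_def pre_digraph.awalk_def c)
qed

lemma (in wf_digraph) apath_ends_in_awalk_verts:
  assumes "apath u p v"
  shows "u \<in> set (awalk_verts u p)" "v \<in> set (awalk_verts u p)"
proof -
  have "hd (awalk_verts u p) = u" "last (awalk_verts u p) = v"
    using assms by (auto simp: apath_def elim: awalkE)
  then show "u \<in> set (awalk_verts u p)" "v \<in> set (awalk_verts u p)"
    by (metis awalk_verts_non_Nil hd_in_set last_in_set)+
qed

lemma length_bad_matching_le:
  assumes conn: "connector n G ins outs" and n: "n \<ge> 1" and D: "finite D"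
    and zs: "bad_matching G ins outs D zs"
  shows "length zs \<le> card D"
proof -
  have io: "io_dag n G ins outs" using conn by (simp add: connector_def)
  then interpret digraph G by (simp add: io_dag_def dag_def)
  have ci: "card ins = n" "card outs = n" using io by (auto simp: io_dag_def)
  \<comment> \<open>An infinite set has \<open>card\<close> 0, which \<open>n \<ge> 1\<close> rules
    out.\<close>
  have "finite ins" "finite outs" using ci n card.infinite by fastforce+
  moreover have "set (map fst zs) \<subseteq> ins" "set (map snd zs) \<subseteq> outs"
    using zs by (auto simp: bad_matching_def)
  ultimately obtain xs' ys' where
    xs': "distinct (map fst zs @ xs')" "set (map fst zs @ xs') = ins" and
    ys': "distinct (map snd zs @ ys')" "set (map snd zs @ ys') = outs"
    using zs unfolding bad_matching_def by (metis distinct_list_extend)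
  define xs ys where "xs = map fst zs @ xs'" and "ys = map snd zs @ ys'"
  have xs: "distinct xs" "set xs = ins" "length xs = n"
    and ys: "distinct ys" "set ys = outs" "length ys = n"
    using xs' ys' ci distinct_card[of xs] distinct_card[of ys] by (auto simp: xs_def ys_def)
  define W where "W p i = set (awalk_verts (xs ! i) (p i))" for p :: "nat \<Rightarrow> 'b awalk" and i
  obtain p where p: "\<And>i. i < n \<Longrightarrow> apath (xs ! i) (p i) (ys ! i)"
    and disj: "\<And>i j. i < n \<Longrightarrow> j < n \<Longrightarrow> i \<noteq> j \<Longrightarrow> W p i \<inter> W p j = {}"
    using conn xs ys n unfolding connector_def W_def by (metis order_refl)
  have ends: "xs ! i \<in> W p i" "ys ! i \<in> W p i" if "i < n" for i
    using apath_ends_in_awalk_verts[OF p[OF that]] by (auto simp: W_def)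
  \<comment> \<open>Every input is some \<open>xs ! j\<close> and lies on its own path
    \<open>W p j\<close>, which is disjoint from \<open>W p i\<close> unless
    \<open>j = i\<close>.\<close>
  have ins: "W p i \<inter> ins \<subseteq> {xs ! i}" if "i < n" for i
    using disj[OF that] ends xs by (fastforce simp: in_set_conv_nth)
  have outs: "W p i \<inter> outs \<subseteq> {ys ! i}" if "i < n" for i
    using disj[OF that] ends ys by (fastforce simp: in_set_conv_nth)
  have len: "length zs \<le> n" using xs(3) by (simp add: xs_def)
  have "W p i \<inter> D \<noteq> {}" if i: "i < length zs" for i
  proof
    assume "W p i \<inter> D = {}"
    then have "clean_path G ins outs D (xs ! i) (p i) (ys ! i)"
      using p ins outs i len by (simp add: clean_path_def W_def)
    moreover have "zs ! i = (xs ! i, ys ! i)"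
      using i by (simp add: xs_def ys_def nth_append)
    ultimately show False
      using zs nth_mem[OF i] by (auto simp: bad_matching_def)
  qed
  then have "\<forall>i. \<exists>v. i < length zs \<longrightarrow> v \<in> W p i \<inter> D" by blast
  then obtain d where d: "\<And>i. i < length zs \<Longrightarrow> d i \<in> W p i \<inter> D" by metis
  have "inj_on d {..<length zs}"
  proof (rule inj_onI)
    fix i j assume "i \<in> {..<length zs}" "j \<in> {..<length zs}" "d i = d j"
    then show "i = j" using d[of i] d[of j] disj[of i j] len by fastforce
  qed
  moreover have "d ` {..<length zs} \<subseteq> D" using d by auto
  ultimately show ?thesis using card_inj_on_le[of d "{..<length zs}" D] D by simp
qed

lemma connector_imp_ST_robust:
  assumes conn: "connector n G ins outs" and k: "1 \<le> k" "k \<le> n"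
  shows "ST_robust n G ins outs k (n - k)"
proof -
  have io: "io_dag n G ins outs" using conn by (simp add: connector_def)
  then interpret digraph G by (simp add: io_dag_def dag_def)
  have io': "card ins = n" "card outs = n" "ins \<subseteq> verts G" "outs \<subseteq> verts G"
    using io by (auto simp: io_dag_def)
  have "\<exists>H. subgraph H (G \<restriction> (verts G - D)) \<and> n - k \<le> card (ins \<inter> verts H) \<and>
             n - k \<le> card (outs \<inter> verts H) \<and>
             (\<forall>s \<in> ins \<inter> verts H. \<forall>t \<in> outs \<inter> verts H. \<exists>p. pre_digraph.apath H s p t)"
    if D: "D \<subseteq> verts G" "card D \<le> k" for D
  proof -
    have "finite D" using D finite_verts finite_subset by blast
    then have bound: "length zs \<le> k" if "bad_matching G ins outs D zs" for zs
      using length_bad_matching_le[OF conn _ _ that] k D by fastforce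
    have "bad_matching G ins outs D []" by (simp add: bad_matching_def)
    \<comment> \<open>\<open>Suc k\<close> serves as the strict upper bound on the lengths that the
      existence of a maximum requires.\<close>
    then obtain zs where zs: "bad_matching G ins outs D zs"
      and max: "\<And>zs'. bad_matching G ins outs D zs' \<Longrightarrow> length zs' \<le> length zs"
      using ex_has_greatest_nat[of "bad_matching G ins outs D" "[]" length "Suc k"] bound
      by (metis le_imp_less_Suc)
    define A B where "A = ins - fst ` set zs" and "B = outs - snd ` set zs"
    have "card (fst ` set zs) \<le> k" "card (snd ` set zs) \<le> k"
      using bound[OF zs] card_length[of "map fst zs"] card_length[of "map snd zs"] by auto
    then have cAB: "n - k \<le> card A" "n - k \<le> card B"
      using diff_card_le_card_Diff[of "fst ` set zs" ins]
        diff_card_le_card_Diff[of "snd ` set zs" outs] io' by (auto simp: A_def B_def)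
    have clean: "\<exists>p. clean_path G ins outs D s p t" if "s \<in> A" "t \<in> B" for s t
    proof (rule ccontr)
      assume "\<nexists>p. clean_path G ins outs D s p t"
      then have "bad_matching G ins outs D ((s, t) # zs)"
        using zs that by (auto simp: bad_matching_def A_def B_def)
      then show False using max by fastforce
    qed
    define S where "S = verts G - D - (ins - A) - (outs - B)"
    have path: "\<exists>p. apath s p t \<and> set (awalk_verts s p) \<subseteq> S" if st: "s \<in> A" "t \<in> B" for s t
    proof -
      obtain p where p: "clean_path G ins outs D s p t" using clean[OF st] by blast
      then have "set (awalk_verts s p) \<subseteq> verts G"
        by (auto simp: clean_path_def apath_def elim: awalkE)
      \<comment> \<open>The only input on \<open>p\<close> is \<open>s\<close>, which lies in
        \<open>A\<close>, so \<open>p\<close> avoids \<open>ins - A\<close>; likewise it avoids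
        \<open>outs - B\<close>.\<close>
      then show ?thesis using p st unfolding clean_path_def S_def by blast
    qed
    \<comment> \<open>By definition alone, \<open>A\<close> could still meet \<open>D\<close> or, as
      terminals may be both inputs and outputs, \<open>outs - B\<close>. The ends of a clean path do
      neither.\<close>
    have mem: "s \<in> S \<and> t \<in> S" if st: "s \<in> A" "t \<in> B" for s t
    proof -
      obtain p where p: "apath s p t" "set (awalk_verts s p) \<subseteq> S" using path[OF st] by blast
      then show ?thesis using apath_ends_in_awalk_verts by blast
    qed
    have sub: "ins \<inter> S \<subseteq> A" "outs \<inter> S \<subseteq> B" by (auto simp: S_def)
    have card: "n - k \<le> card (ins \<inter> S) \<and> n - k \<le> card (outs \<inter> S)"
    \<comment> \<open>If \<open>A\<close> or \<open>B\<close> is empty, no path places the other one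
      inside \<open>S\<close>, but then \<open>cAB\<close> forces \<open>n - k = 0\<close>.\<close>
    proof (cases "A = {} \<or> B = {}")
      case True
      then show ?thesis using cAB by auto
    next
      case False
      then have "ins \<inter> S = A" "outs \<inter> S = B" using mem sub by (auto simp: A_def B_def)
      then show ?thesis using cAB by simp
    qed
    have "subgraph (G \<restriction> S) (G \<restriction> (verts G - D))"
      by (auto simp: subgraph_def compatible_def S_def wellformed_induce_subgraph)
    moreover have "\<exists>p. pre_digraph.apath (G \<restriction> S) s p t"
      if "s \<in> ins \<inter> S" "t \<in> outs \<inter> S" for s t
      using path apath_induce_subgraph that sub by blast
    ultimately show ?thesis using card by (intro exI[of _ "G \<restriction> S"]) auto
  qed
  then show ?thesis using io by (simp add: ST_robust_def)
qed

theorem theorem3: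
  fixes G :: "('a, 'b) pre_digraph" and ins outs :: "'a set" and n :: nat
  assumes "connector n G ins outs"
  shows "\<forall>k. 1 \<le> k \<and> k \<le> n \<longrightarrow> ST_robust n G ins outs k (n - k)"
  using connector_imp_ST_robust[OF assms] by blast

end
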